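(* Let $u,v\in\ell^+$. The inequality \[ \sup_n\Big|\frac1n\sum_{k=1}^nx_k\Big|v_n\le A\sup_k\frac{|x_k|}{u_k} \] holds for all real sequences $x$ with $A=A(C)$; for all nonnegative sequences $x$ with $A=A^+(C)$; for all nonnegative, nonincreasing sequences $x$ with $A=A^\downarrow(C)$; and for all nonnegative, nondecreasing sequences $x$ with $A=A^\uparrow(C)$. In each case the constant $A$ is best possible. Here \begin{align*} A(C)=A^+(C)&=\|Cu\|_{\ell^\infty(v)}=\sup_n\frac{v_n}n\sum_{k=1}^nu_k;\\ A^\downarrow(C)&=\|C(u^\downarrow)\|_{\ell^\infty(v)}=\sup_n\frac{v_n}n\sum_{k=1}^n\min_{j\le k}u_j;\\ A^\uparrow(C)&=\|C(u^\uparrow)\|_{\ell^\infty(v)}=\sup_n\frac{v_n}n\sum_{k=1}^n\inf_{j\ge k}u_j. \end{align*}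
   Context: All sequences are indexed by the positive integers, and $\ell^+$ is the set of nonnegative real sequences. $C$ is the Cesàro operator, $(Cx)_n=\frac1n\sum_{k=1}^nx_k$; $\|y\|_{\ell^\infty(v)}=\sup_n|y_n|v_n$; $u^\downarrow_k=\min_{j\le k}u_j$, $u^\uparrow_k=\inf_{j\ge k}u_j$. If $u_k=0$, then $|x_k|/u_k$ is $0$ when $x_k=0$ and $\infty$ when $x_k\ne0$. Suprema may take the value $\infty$. Best possible means that $A$ is the smallest constant in $[0,\infty]$ for which the inequality holds for all sequences of the stated kind. Some expressions need to be understood according to the convention $\infty\cdot0=0$.
   Formalization: The inequality is taken to hold automatically when sup |x_k|/u_k = ∞, even for A = 0; with 0·∞ = 0 on the right-hand side the claim would fail, e.g. for u = 0, v = 1, x = (1,0,0,…). *)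

theory Defs
  imports "HOL-Analysis.Analysis"
begin

text \<open>
  A sequence indexed by the positive integers is a function on \<^typ>\<open>nat\<close> of which only the
  values at indices \<open>\<ge> 1\<close> matter; the value at 0 is never constrained or used.
\<close>

definition nonneg_seqs :: "(nat \<Rightarrow> real) set" where
  "nonneg_seqs = {x. \<forall>k\<ge>1. 0 \<le> x k}"

definition cesaro :: "(nat \<Rightarrow> real) \<Rightarrow> nat \<Rightarrow> real" where
  "cesaro x n = 1 / real n * (\<Sum>k=1..n. x k)"

definition linf_norm :: "(nat \<Rightarrow> real) \<Rightarrow> (nat \<Rightarrow> real) \<Rightarrow> ennreal" where
  "linf_norm v y = (SUP n\<in>{1..}. ennreal (\<bar>y n\<bar> * v n))"

text \<open>
  In \<^typ>\<open>ennreal\<close>, \<open>0 / 0 = 0\<close> and \<open>a / 0 = \<infinity>\<close> for \<open>a \<noteq> 0\<close>. These are the intended values of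
  \<open>\<bar>x k\<bar> / u k\<close> at indices with \<open>u k = 0\<close>.
\<close>
definition linf_quot_norm :: "(nat \<Rightarrow> real) \<Rightarrow> (nat \<Rightarrow> real) \<Rightarrow> ennreal" where
  "linf_quot_norm u x = (SUP k\<in>{1..}. ennreal \<bar>x k\<bar> / ennreal (u k))"

definition down_seq :: "(nat \<Rightarrow> real) \<Rightarrow> nat \<Rightarrow> real" where
  "down_seq u k = (MIN j\<in>{1..k}. u j)"

definition up_seq :: "(nat \<Rightarrow> real) \<Rightarrow> nat \<Rightarrow> real" where
  "up_seq u k = (INF j\<in>{k..}. u j)"

text \<open>
  The inequality \<open>sup\<^sub>n \<bar>(Cx)\<^sub>n\<bar> v\<^sub>n \<le> A sup\<^sub>k \<bar>x\<^sub>k\<bar> / u\<^sub>k\<close>, which is void when the supremum on the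
  right is infinite. The case distinction only matters for \<open>A = 0\<close>, where the product
  \<open>0 * \<infinity> = 0\<close> of \<^typ>\<open>ennreal\<close> would turn it into a condition on sequences outside the
  weighted space: for \<open>u = 0\<close> and \<open>v = 1\<close>, say, every \<open>A > 0\<close> would then be admissible but \<open>A = 0\<close>
  would not, so that there would be no smallest constant. In the product \<open>A * 0\<close> with \<open>A = \<infinity>\<close>,
  the convention \<open>\<infinity> * 0 = 0\<close> is in force.
\<close>
definition cesaro_ineq ::
  "(nat \<Rightarrow> real) \<Rightarrow> (nat \<Rightarrow> real) \<Rightarrow> ennreal \<Rightarrow> (nat \<Rightarrow> real) \<Rightarrow> bool" where
  "cesaro_ineq u v A x \<longleftrightarrow>
     (linf_quot_norm u x < \<infinity> \<longrightarrow> linf_norm v (cesaro x) \<le> A * linf_quot_norm u x)"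

lemma cesaro_ineq_pos_iff:
  assumes "A \<noteq> 0"
  shows "cesaro_ineq u v A x \<longleftrightarrow> linf_norm v (cesaro x) \<le> A * linf_quot_norm u x"
  using assms by (auto simp: cesaro_ineq_def ennreal_mult_top less_top[symmetric])

definition best_constant ::
  "(nat \<Rightarrow> real) \<Rightarrow> (nat \<Rightarrow> real) \<Rightarrow> (nat \<Rightarrow> real) set \<Rightarrow> ennreal \<Rightarrow> bool" where
  "best_constant u v X A \<longleftrightarrow>
     (\<forall>x\<in>X. cesaro_ineq u v A x) \<and>
     (\<forall>B. (\<forall>x\<in>X. cesaro_ineq u v B x) \<longrightarrow> A \<le> B)"

end

theory Submission imports Defs begin

text \<open>
  A sequence \<open>x\<close> satisfies \<open>sup\<^sub>k \<bar>x\<^sub>k\<bar> / u\<^sub>k \<le> t\<close> exactly when \<open>\<bar>x\<^sub>k\<bar> \<le> t u\<^sub>k\<close> for all \<open>k\<close>. Suppose that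
  a class \<open>X\<close> of sequences contains a majorant \<open>w\<close>: one with \<open>0 \<le> w \<le> u\<close> such that every \<open>x\<close>
  in \<open>X\<close> that is bounded by \<open>t u\<close> is already bounded by \<open>t w\<close>. The operator \<open>C\<close> is positive, so it
  preserves this bound: \<open>\<bar>C x\<bar> \<le> t C w\<close>, which is the inequality with constant
  \<open>\<parallel>C w\<parallel>\<close>. The sequence \<open>w\<close> lies in \<open>X\<close> and in the unit ball of the weighted space, so no smaller
  constant will do. This is lemma \<open>best_constant_majorant\<close>.

  The majorant is \<open>u\<close> for all sequences and for nonnegative sequences. A
  nonincreasing sequence bounded by \<open>t u\<close> satisfies \<open>x\<^sub>k \<le> x\<^sub>j \<le> t u\<^sub>j\<close> for every \<open>j \<le> k\<close>, so the
  running minimum of \<open>u\<close>, which is itself nonincreasing, is a majorant; a nondecreasing one satisfies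
  the same for every \<open>j \<ge> k\<close>, and the infimum over the tails takes the place of the minimum.
\<close>

lemma abs_le_of_linf_quot_norm_le:
  assumes "linf_quot_norm u x \<le> ennreal t" "0 \<le> t" "1 \<le> k" "0 \<le> u k"
  shows "\<bar>x k\<bar> \<le> t * u k"
proof -
  have le: "ennreal \<bar>x k\<bar> / ennreal (u k) \<le> ennreal t"
    using assms(1,3) by (force simp: linf_quot_norm_def SUP_le_iff)
  show ?thesis
  proof (cases "u k = 0")
    case True
    \<comment> \<open>A quotient with denominator 0 is finite only if the numerator vanishes.\<close>
    then show ?thesis
      using le by (cases "x k = 0") (auto simp: ennreal_divide_zero top_unique)
  next
    case False
    with assms(4) have "0 < u k" by simp
    then show ?thesis
      using le assms(2) by (simp add: divide_ennreal field_simps)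
  qed
qed

lemma linf_quot_norm_le_1:
  assumes "\<And>k. 1 \<le> k \<Longrightarrow> \<bar>x k\<bar> \<le> u k"
  shows "linf_quot_norm u x \<le> 1"
  unfolding linf_quot_norm_def
proof (rule SUP_least)
  fix k :: nat
  assume "k \<in> {1..}"
  then have le: "\<bar>x k\<bar> \<le> u k" using assms by simp
  show "ennreal \<bar>x k\<bar> / ennreal (u k) \<le> 1"
  proof (cases "u k = 0")
    case True
    then show ?thesis using le by simp
  next
    case False
    then have "0 < u k" using le by linarith
    then show ?thesis using le by (simp add: divide_ennreal)
  qed
qed

lemma cesaro_nonneg:
  assumes "w \<in> nonneg_seqs"
  shows "0 \<le> cesaro w n"
  using assms by (auto simp: cesaro_def nonneg_seqs_def intro!: divide_nonneg_nonneg sum_nonneg)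

lemma abs_cesaro_le:
  assumes "\<And>k. 1 \<le> k \<Longrightarrow> \<bar>x k\<bar> \<le> t * w k"
  shows "\<bar>cesaro x n\<bar> \<le> t * cesaro w n"
proof -
  have "\<bar>\<Sum>k=1..n. x k\<bar> \<le> (\<Sum>k=1..n. t * w k)"
    using assms by (intro order_trans[OF sum_abs] sum_mono) simp
  then show ?thesis
    by (simp add: cesaro_def abs_mult sum_distrib_left[symmetric] divide_right_mono)
qed

lemma linf_norm_cesaro_le:
  assumes "v \<in> nonneg_seqs" "w \<in> nonneg_seqs" "0 \<le> t"
    and "\<And>k. 1 \<le> k \<Longrightarrow> \<bar>x k\<bar> \<le> t * w k"
  shows "linf_norm v (cesaro x) \<le> linf_norm v (cesaro w) * ennreal t"
  unfolding linf_norm_def[of v "cesaro x"]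
proof (rule SUP_least)
  fix n :: nat
  assume n: "n \<in> {1..}"
  then have v: "0 \<le> v n" using assms(1) by (simp add: nonneg_seqs_def)
  have "\<bar>cesaro x n\<bar> * v n \<le> (t * cesaro w n) * v n"
    by (intro mult_right_mono abs_cesaro_le assms(4) v)
  also have "\<dots> = (\<bar>cesaro w n\<bar> * v n) * t"
    using cesaro_nonneg[OF assms(2)] by simp
  finally have "ennreal (\<bar>cesaro x n\<bar> * v n) \<le> ennreal (\<bar>cesaro w n\<bar> * v n) * ennreal t"
    using v assms(3) by (simp add: ennreal_mult[symmetric] ennreal_leI)
  also have "\<dots> \<le> linf_norm v (cesaro w) * ennreal t"
    using n by (auto simp: linf_norm_def intro!: mult_right_mono SUP_upper)
  finally show "ennreal (\<bar>cesaro x n\<bar> * v n) \<le> linf_norm v (cesaro w) * ennreal t" .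
qed

text \<open>
  By \<open>major\<close> and \<open>wu\<close> the weights \<open>u\<close> and \<open>w\<close> bound the same members of \<open>X\<close>, and positivity
  of the averaging operator gives the inequality. Testing it on \<open>w\<close>, which has weighted norm at
  most 1, shows that the constant is smallest.
\<close>
lemma best_constant_majorant:
  assumes u: "u \<in> nonneg_seqs" and v: "v \<in> nonneg_seqs" and w: "w \<in> nonneg_seqs"
    and wX: "w \<in> X" and wu: "\<And>k. 1 \<le> k \<Longrightarrow> w k \<le> u k"
    and major: "\<And>x t k. \<lbrakk>x \<in> X; 0 \<le> t; \<And>j. 1 \<le> j \<Longrightarrow> \<bar>x j\<bar> \<le> t * u j; 1 \<le> k\<rbrakk> \<Longrightarrow> \<bar>x k\<bar> \<le> t * w k"
  shows "best_constant u v X (linf_norm v (cesaro w))"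
  unfolding best_constant_def
proof (intro conjI ballI allI impI)
  fix x
  assume x: "x \<in> X"
  show "cesaro_ineq u v (linf_norm v (cesaro w)) x"
    unfolding cesaro_ineq_def
  proof
    assume "linf_quot_norm u x < \<infinity>"
    then obtain t where t: "0 \<le> t" "linf_quot_norm u x = ennreal t"
      by (cases "linf_quot_norm u x") auto
    then have "\<bar>x j\<bar> \<le> t * u j" if "1 \<le> j" for j
      using u that by (intro abs_le_of_linf_quot_norm_le) (auto simp: nonneg_seqs_def)
    then have "\<bar>x k\<bar> \<le> t * w k" if "1 \<le> k" for k
      using x t(1) that by (intro major)
    then show "linf_norm v (cesaro x) \<le> linf_norm v (cesaro w) * linf_quot_norm u x"
      unfolding t(2) by (intro linf_norm_cesaro_le v w t(1))
  qed
next
  fix B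
  assume B: "\<forall>x\<in>X. cesaro_ineq u v B x"
  have le1: "linf_quot_norm u w \<le> 1"
    using w wu by (intro linf_quot_norm_le_1) (simp add: nonneg_seqs_def)
  then have "linf_quot_norm u w < \<infinity>"
    using ennreal_one_less_top by (simp add: order_le_less_trans)
  then have "linf_norm v (cesaro w) \<le> B * linf_quot_norm u w"
    using B wX by (simp add: cesaro_ineq_def)
  also have "\<dots> \<le> B * 1"
    using le1 by (intro mult_left_mono) auto
  finally show "linf_norm v (cesaro w) \<le> B" by simp
qed

lemma down_seq_le:
  assumes "1 \<le> j" "j \<le> k"
  shows "down_seq u k \<le> u j"
  using assms by (auto simp: down_seq_def intro!: Min_le)

lemma down_seq_greatest:
  assumes "1 \<le> k" "\<And>j. \<lbrakk>1 \<le> j; j \<le> k\<rbrakk> \<Longrightarrow> c \<le> u j"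
  shows "c \<le> down_seq u k"
  using assms by (auto simp: down_seq_def)

lemma down_seq_antimono: "antimono_on {1..} (down_seq u)"
  by (intro monotone_onI down_seq_greatest down_seq_le) auto

lemma down_seq_nonneg:
  assumes "u \<in> nonneg_seqs"
  shows "down_seq u \<in> nonneg_seqs"
  using assms unfolding nonneg_seqs_def by (blast intro: down_seq_greatest)

text \<open>
  Nonnegativity of \<open>u\<close> supplies the lower bound without which a real infimum over an infinite set
  carries no information.
\<close>
lemma up_seq_le:
  assumes "u \<in> nonneg_seqs" "1 \<le> k" "k \<le> j"
  shows "up_seq u k \<le> u j"
proof -
  have "bdd_below (u ` {k..})"
    using assms by (intro bdd_belowI[of _ 0]) (auto simp: nonneg_seqs_def)
  then show ?thesis
    using assms(3) by (auto simp: up_seq_def intro: cINF_lower)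
qed

lemma up_seq_greatest:
  assumes "\<And>j. k \<le> j \<Longrightarrow> c \<le> u j"
  shows "c \<le> up_seq u k"
  using assms by (auto simp: up_seq_def intro!: cINF_greatest)

lemma up_seq_mono:
  assumes "u \<in> nonneg_seqs"
  shows "mono_on {1..} (up_seq u)"
  using assms by (intro monotone_onI up_seq_greatest up_seq_le) auto

lemma up_seq_nonneg:
  assumes "u \<in> nonneg_seqs"
  shows "up_seq u \<in> nonneg_seqs"
  using assms by (auto simp: nonneg_seqs_def intro!: up_seq_greatest)

lemma le_mult_down_seq:
  assumes x: "x \<in> nonneg_seqs" "antimono_on {1..} x"
    and le: "\<And>j. 1 \<le> j \<Longrightarrow> \<bar>x j\<bar> \<le> t * u j" and k: "1 \<le> k"
  shows "\<bar>x k\<bar> \<le> t * down_seq u k"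
proof -
  \<comment> \<open>The minimum is attained, so a single comparison suffices.\<close>
  have "Min (u ` {1..k}) \<in> u ` {1..k}"
    using k by (intro Min_in) auto
  then obtain j where j: "j \<in> {1..k}" "down_seq u k = u j"
    by (auto simp: down_seq_def)
  have "\<bar>x k\<bar> \<le> \<bar>x j\<bar>"
    using monotone_onD[OF x(2), of j k] x(1) j(1) k by (auto simp: nonneg_seqs_def)
  also have "\<dots> \<le> t * u j" using le j(1) by simp
  finally show ?thesis using j(2) by simp
qed

lemma le_mult_up_seq:
  assumes x: "x \<in> nonneg_seqs" "mono_on {1..} x" and t: "0 \<le> t"
    and le: "\<And>j. 1 \<le> j \<Longrightarrow> \<bar>x j\<bar> \<le> t * u j" and k: "1 \<le> k"
  shows "\<bar>x k\<bar> \<le> t * up_seq u k"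
proof (cases "t = 0")
  case True
  then show ?thesis using le[OF k] by simp
next
  \<comment> \<open>The infimum need not be attained, so the bound is divided by \<open>t\<close> before it is taken.\<close>
  case False
  with t have pos: "0 < t" by simp
  have "\<bar>x k\<bar> / t \<le> u j" if "k \<le> j" for j
  proof -
    have "\<bar>x k\<bar> \<le> \<bar>x j\<bar>"
      using monotone_onD[OF x(2), of k j] x(1) that k by (auto simp: nonneg_seqs_def)
    also have "\<dots> \<le> t * u j" using le that k by simp
    finally show ?thesis using pos by (simp add: field_simps)
  qed
  then have "\<bar>x k\<bar> / t \<le> up_seq u k" by (rule up_seq_greatest)
  then show ?thesis using pos by (simp add: field_simps)
qed

lemma linf_norm_cesaro_eq:
  assumes "w \<in> nonneg_seqs"
  shows "linf_norm v (cesaro w) = (SUP n\<in>{1..}. ennreal (v n / real n * (\<Sum>k=1..n. w k)))"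
  unfolding linf_norm_def
proof (intro SUP_cong refl)
  fix n :: nat
  show "ennreal (\<bar>cesaro w n\<bar> * v n) = ennreal (v n / real n * (\<Sum>k=1..n. w k))"
  proof -
    have "\<bar>cesaro w n\<bar> * v n = cesaro w n * v n"
      using cesaro_nonneg[OF assms] by simp
    also have "\<dots> = v n / real n * (\<Sum>k=1..n. w k)"
      by (simp add: cesaro_def mult.commute)
    finally show ?thesis by simp
  qed
qed

theorem corollary3p4:
  fixes u v :: "nat \<Rightarrow> real"
  assumes "u \<in> nonneg_seqs" and "v \<in> nonneg_seqs"
  shows
    "best_constant u v UNIV (linf_norm v (cesaro u)) \<and>
     best_constant u v nonneg_seqs (linf_norm v (cesaro u)) \<and>
     best_constant u v {x \<in> nonneg_seqs. antimono_on {1..} x} (linf_norm v (cesaro (down_seq u))) \<and>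
     best_constant u v {x \<in> nonneg_seqs. mono_on {1..} x} (linf_norm v (cesaro (up_seq u))) \<and>
     linf_norm v (cesaro u) =
       (SUP n\<in>{1..}. ennreal (v n / real n * (\<Sum>k=1..n. u k))) \<and>
     linf_norm v (cesaro (down_seq u)) =
       (SUP n\<in>{1..}. ennreal (v n / real n * (\<Sum>k=1..n. MIN j\<in>{1..k}. u j))) \<and>
     linf_norm v (cesaro (up_seq u)) =
       (SUP n\<in>{1..}. ennreal (v n / real n * (\<Sum>k=1..n. INF j\<in>{k..}. u j)))"
proof (intro conjI)
  note u = assms(1) and v = assms(2)
  show "best_constant u v UNIV (linf_norm v (cesaro u))"
    "best_constant u v nonneg_seqs (linf_norm v (cesaro u))"
    using u v by (auto intro: best_constant_majorant)
  show "best_constant u v {x \<in> nonneg_seqs. antimono_on {1..} x} (linf_norm v (cesaro (down_seq u)))"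
    using u v
    by (intro best_constant_majorant)
      (auto intro: down_seq_nonneg down_seq_antimono down_seq_le le_mult_down_seq
        simp del: One_nat_def)
  show "best_constant u v {x \<in> nonneg_seqs. mono_on {1..} x} (linf_norm v (cesaro (up_seq u)))"
    using u v
    by (intro best_constant_majorant)
      (auto intro: up_seq_nonneg up_seq_mono up_seq_le le_mult_up_seq simp del: One_nat_def)
  show "linf_norm v (cesaro u) = (SUP n\<in>{1..}. ennreal (v n / real n * (\<Sum>k=1..n. u k)))"
    by (rule linf_norm_cesaro_eq[OF u])
  show "linf_norm v (cesaro (down_seq u)) =
      (SUP n\<in>{1..}. ennreal (v n / real n * (\<Sum>k=1..n. MIN j\<in>{1..k}. u j)))"
    using linf_norm_cesaro_eq[OF down_seq_nonneg[OF u]] by (simp add: down_seq_def)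
  show "linf_norm v (cesaro (up_seq u)) =
      (SUP n\<in>{1..}. ennreal (v n / real n * (\<Sum>k=1..n. INF j\<in>{k..}. u j)))"
    using linf_norm_cesaro_eq[OF up_seq_nonneg[OF u]] by (simp add: up_seq_def)
qed

end
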